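(* Let $\lambda>0$, let $\hat\beta$ be the square-root Lasso, i.e. a minimizer over $\beta\in\mathbb{R}^p$ of $\|Y-X\beta\|_n+\lambda\|\beta\|_1$, where $Y=X\beta^0+\epsilon$, and let $\hat\epsilon:=Y-X\hat\beta$. Then $$\|\hat\epsilon\|_n\le\|\epsilon\|_n+\lambda\|\beta^0\|_1 .$$ Moreover, if for a constant $\lambda_0>0$ satisfying $\lambda_0\|\epsilon\|_n\ge\|\epsilon^TX\|_\infty/n$ the tuning parameter $\lambda$ has $\lambda(1-\eta^2)>2\lambda_0$ for some $\eta>0$ and $$\|\beta^0\|_1\le\frac{\|\epsilon\|_n}{4\lambda_0}\Big(1-\eta^2-\frac{2\lambda_0}{\lambda}\Big),$$ then $\|\hat\epsilon\|_n^2\ge\eta^2\|\epsilon\|_n^2$.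
   Context: $X$ is a fixed $n\times p$ real matrix of rank $n$, $Y\in\mathbb{R}^n$, $f^0=\mathbb{E}Y$, $\beta^0\in\mathbb{R}^p$ is a solution of $X\beta^0=f^0$, and $\epsilon:=Y-f^0$, so $Y=X\beta^0+\epsilon$ (the result is deterministic: it holds for any realization of $\epsilon$). For $v\in\mathbb{R}^n$, $\|v\|_n:=\sqrt{v^Tv/n}$; $\|\cdot\|_1,\|\cdot\|_\infty$ are the $\ell_1$- and $\ell_\infty$-norms of vectors. *)

theory Defs
  imports "HOL-Probability.Probability"
begin

definition norm_n :: "real ^ 'n \<Rightarrow> real" where
  "norm_n v = sqrt ((v \<bullet> v) / real CARD('n))"

definition norm_1 :: "real ^ 'p \<Rightarrow> real" where
  "norm_1 b = (\<Sum>j\<in>UNIV. \<bar>b $ j\<bar>)"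

text \<open>The minimizer need not be unique, so the estimator is a predicate on \<open>b\<close>.\<close>

definition is_sqrt_lasso ::
  "real ^ 'p ^ 'n \<Rightarrow> real ^ 'n \<Rightarrow> real \<Rightarrow> real ^ 'p \<Rightarrow> bool" where
  "is_sqrt_lasso X y lam b \<longleftrightarrow>
     is_arg_min (\<lambda>b. norm_n (y - X *v b) + lam * norm_1 b) (\<lambda>_. True) b"

end

theory Submission
  imports Defs
begin

text \<open>
  Comparing the objective at \<open>\<beta>hat\<close> with its value at \<open>\<beta>0\<close> gives the basic inequality
  \<open>norm_n \<epsilon>hat + lam * norm_1 \<beta>hat \<le> norm_n \<epsilon> + lam * norm_1 \<beta>0\<close>, hence the upper bound and
  \<open>norm_1 \<beta>hat \<le> norm_n \<epsilon> / lam + norm_1 \<beta>0\<close>. For the lower bound, expand the square of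
  \<open>\<epsilon>hat = \<epsilon> - X (\<beta>hat - \<beta>0)\<close>, drop the square of \<open>X (\<beta>hat - \<beta>0)\<close>, and bound the cross term
  by duality of the \<open>\<ell>\<^sub>1\<close> and \<open>\<ell>\<^sub>\<infinity>\<close> norms.
\<close>

lemma norm_n_nonneg: "0 \<le> norm_n v"
  by (simp add: norm_n_def)

lemma power2_norm_n: "(norm_n (v :: real ^ 'n))\<^sup>2 = (v \<bullet> v) / real CARD('n)"
  by (simp add: norm_n_def)

lemma norm_1_nonneg: "0 \<le> norm_1 b"
  by (simp add: norm_1_def sum_nonneg)

lemma norm_1_diff_le: "norm_1 (a - b) \<le> norm_1 a + norm_1 b"
  unfolding norm_1_def sum.distrib[symmetric]
  by (rule sum_mono) (simp add: abs_triangle_ineq4)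

text \<open>Hoelder's inequality for the dual pair of exponents 1 and infinity, proved
  coordinatewise: each \<open>\<bar>u $ j\<bar>\<close> is at most the maximum
  \<open>infnorm u\<close>.\<close>

lemma inner_le_infnorm_norm_1: "u \<bullet> b \<le> infnorm u * norm_1 b"
proof -
  have "u \<bullet> b = (\<Sum>j\<in>UNIV. u $ j * b $ j)"
    by (simp add: inner_vec_def)
  also have "\<dots> \<le> (\<Sum>j\<in>UNIV. infnorm u * \<bar>b $ j\<bar>)"
  proof (rule sum_mono)
    fix j
    have "u $ j * b $ j \<le> \<bar>u $ j\<bar> * \<bar>b $ j\<bar>"
      by (metis abs_ge_self abs_mult)
    also have "\<dots> \<le> infnorm u * \<bar>b $ j\<bar>"
      by (intro mult_right_mono component_le_infnorm_cart) simp
    finally show "u $ j * b $ j \<le> infnorm u * \<bar>b $ j\<bar>" .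
  qed
  also have "\<dots> = infnorm u * norm_1 b"
    by (simp add: norm_1_def sum_distrib_left)
  finally show ?thesis .
qed

text \<open>Moving \<open>X\<close> to the other side of the inner product turns the cross term into
  \<open>(e v* X) \<bullet> d\<close>, so only the correlation of the noise with the columns of
  \<open>X\<close> enters.\<close>

lemma power2_norm_n_diff_matrix_ge:
  fixes X :: "real ^ 'p ^ 'n" and e :: "real ^ 'n" and d :: "real ^ 'p"
  shows "(norm_n (e - X *v d))\<^sup>2
    \<ge> (norm_n e)\<^sup>2 - 2 * (infnorm (e v* X) / real CARD('n)) * norm_1 d"
proof -
  have "e \<bullet> (X *v d) \<le> infnorm (e v* X) * norm_1 d"
    using inner_le_infnorm_norm_1[of "e v* X" d] by (simp add: dot_lmul_matrix)
  moreover have "(e - X *v d) \<bullet> (e - X *v d)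
      = e \<bullet> e - 2 * (e \<bullet> (X *v d)) + (X *v d) \<bullet> (X *v d)"
    by (simp add: inner_diff inner_commute algebra_simps)
  ultimately have "(e - X *v d) \<bullet> (e - X *v d) \<ge> e \<bullet> e - 2 * (infnorm (e v* X) * norm_1 d)"
    using inner_ge_zero[of "X *v d"] by linarith
  then have "(e \<bullet> e - 2 * (infnorm (e v* X) * norm_1 d)) / real CARD('n)
      \<le> ((e - X *v d) \<bullet> (e - X *v d)) / real CARD('n)"
    by (rule divide_right_mono) simp
  then show ?thesis
    by (simp add: power2_norm_n diff_divide_distrib)
qed

lemma is_sqrt_lasso_le:
  assumes "is_sqrt_lasso X y lam b"
  shows "norm_n (y - X *v b) + lam * norm_1 b \<le> norm_n (y - X *v c) + lam * norm_1 c"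
  using assms by (simp add: is_sqrt_lasso_def is_arg_min_linorder)

theorem lemma1p4p1:
  fixes M :: "'w measure"
    and X :: "real ^ 'p ^ 'n"
    and Y \<epsilon> :: "'w \<Rightarrow> real ^ 'n"
    and f0 \<epsilon>hat :: "real ^ 'n"
    and \<beta>0 \<beta>hat :: "real ^ 'p"
    and lam :: real
    and \<omega> :: 'w
  assumes "prob_space M"
    and "integrable M Y"
    and "f0 = (\<integral>\<omega>. Y \<omega> \<partial>M)"
    and "rank X = CARD('n)"
    and "X *v \<beta>0 = f0"
    and "\<And>\<omega>. \<epsilon> \<omega> = Y \<omega> - f0"
    and "\<omega> \<in> space M"
    and "lam > 0"
    and "is_sqrt_lasso X (Y \<omega>) lam \<beta>hat"
    and "\<epsilon>hat = Y \<omega> - X *v \<beta>hat"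
  shows "norm_n \<epsilon>hat \<le> norm_n (\<epsilon> \<omega>) + lam * norm_1 \<beta>0
    \<and> (\<forall>lam0 \<eta>. lam0 > 0
          \<longrightarrow> lam0 * norm_n (\<epsilon> \<omega>) \<ge> infnorm (\<epsilon> \<omega> v* X) / real CARD('n)
          \<longrightarrow> \<eta> > 0
          \<longrightarrow> lam * (1 - \<eta>\<^sup>2) > 2 * lam0
          \<longrightarrow> norm_1 \<beta>0 \<le> norm_n (\<epsilon> \<omega>) / (4 * lam0) * (1 - \<eta>\<^sup>2 - 2 * lam0 / lam)
          \<longrightarrow> (norm_n \<epsilon>hat)\<^sup>2 \<ge> \<eta>\<^sup>2 * (norm_n (\<epsilon> \<omega>))\<^sup>2)"
proof -
  let ?e = "norm_n (\<epsilon> \<omega>)"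
  \<comment> \<open>The noise is the residual at \<open>\<beta>0\<close>, so the objective at
    \<open>\<beta>0\<close> is the right-hand side of \<open>basic\<close>.\<close>
  have eps: "\<epsilon> \<omega> = Y \<omega> - X *v \<beta>0"
    using assms(5,6) by simp
  have basic: "norm_n \<epsilon>hat + lam * norm_1 \<beta>hat \<le> ?e + lam * norm_1 \<beta>0"
    using is_sqrt_lasso_le[OF assms(9), of \<beta>0] by (simp add: eps assms(10))
  have upper: "norm_n \<epsilon>hat \<le> ?e + lam * norm_1 \<beta>0"
    using basic mult_nonneg_nonneg[of lam "norm_1 \<beta>hat"] norm_1_nonneg[of \<beta>hat] \<open>lam > 0\<close>
    by linarith
  have lower: "(norm_n \<epsilon>hat)\<^sup>2 \<ge> \<eta>\<^sup>2 * ?e\<^sup>2"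
    if lam0: "lam0 > 0" "lam0 * ?e \<ge> infnorm (\<epsilon> \<omega> v* X) / real CARD('n)"
      and \<beta>0: "norm_1 \<beta>0 \<le> ?e / (4 * lam0) * (1 - \<eta>\<^sup>2 - 2 * lam0 / lam)"
    for lam0 \<eta>
  proof -
    have "lam * norm_1 \<beta>hat \<le> ?e + lam * norm_1 \<beta>0"
      using basic norm_n_nonneg[of \<epsilon>hat] by linarith
    then have "norm_1 \<beta>hat \<le> ?e / lam + norm_1 \<beta>0"
      using \<open>lam > 0\<close> by (simp add: field_simps)
    then have diff: "norm_1 (\<beta>hat - \<beta>0) \<le> ?e / lam + 2 * norm_1 \<beta>0"
      using norm_1_diff_le[of \<beta>hat \<beta>0] by linarith
    have residual: "\<epsilon>hat = \<epsilon> \<omega> - X *v (\<beta>hat - \<beta>0)"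
      by (simp add: eps assms(10) matrix_vector_mult_diff_distrib)
    \<comment> \<open>The two factors are bounded separately: the first by the condition on
      \<open>lam0\<close>, the second by \<open>diff\<close>.\<close>
    have "infnorm (\<epsilon> \<omega> v* X) / real CARD('n) * norm_1 (\<beta>hat - \<beta>0)
        \<le> lam0 * ?e * (?e / lam + 2 * norm_1 \<beta>0)"
      using lam0 by (intro mult_mono diff) (simp_all add: norm_n_nonneg norm_1_nonneg)
    then have cross: "(norm_n \<epsilon>hat)\<^sup>2 \<ge> ?e\<^sup>2 - 2 * (lam0 * ?e * (?e / lam + 2 * norm_1 \<beta>0))"
      using power2_norm_n_diff_matrix_ge[of "\<epsilon> \<omega>" X "\<beta>hat - \<beta>0"] residual by simp
    \<comment> \<open>The factor \<open>4 * lam0 * ?e\<close> is the coefficient of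
      \<open>norm_1 \<beta>0\<close> in \<open>cross\<close>. After scaling, the term
      \<open>- 2 * lam0 / lam\<close> of the sparsity bound cancels the loss
      \<open>2 * lam0 * ?e\<^sup>2 / lam\<close> in \<open>cross\<close>, which leaves exactly
      \<open>\<eta>\<^sup>2 * ?e\<^sup>2\<close>.\<close>
    have "4 * lam0 * ?e * norm_1 \<beta>0
        \<le> 4 * lam0 * ?e * (?e / (4 * lam0) * (1 - \<eta>\<^sup>2 - 2 * lam0 / lam))"
      using lam0(1) by (intro mult_left_mono \<beta>0) (simp add: norm_n_nonneg)
    also have "\<dots> = ?e\<^sup>2 * (1 - \<eta>\<^sup>2 - 2 * lam0 / lam)"
      using lam0(1) by (simp add: power2_eq_square)
    finally show ?thesis
      using cross by (simp add: algebra_simps power2_eq_square)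
  qed
  show ?thesis
    using upper lower by blast
qed

end
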